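(* Let $G$ be a graph with minimum degree $\delta(G)=1$, and let $S_1$ be the set of vertices of degree $1$ in $G$. Then $G$ has a $2$-partition $(V_1,V_2)$ such that every vertex of $V_1$ has at least one neighbour in $V_2$ and every vertex of $V_2$ has at least two neighbours in $V_1$ if and only if $S_1$ is a stable set and every vertex of $N(S_1)$ has either two neighbours in $S_1$ or at least one neighbour in $V(G)\setminus (S_1\cup N(S_1))$.
   Context: A $2$-partition of $G$ is a partition $(V_1,V_2)$ of $V(G)$. $N(S_1)$ denotes the set of vertices adjacent to some vertex of $S_1$. *)

theory Defs
  imports "Graph_Theory.Digraph"
begin

text \<open>
  A finite simple graph is the locale \<open>graph\<close>: a finite symmetric digraph
  without loops and parallel arcs. Each undirected edge is a pair of opposite arcs, so
  the degree of a vertex is its \<open>out_degree\<close>.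
\<close>

text \<open>Meaningful only for graphs with at least one vertex.\<close>
definition min_degree :: "('a, 'b) pre_digraph \<Rightarrow> nat" where
  "min_degree G = Min (out_degree G ` verts G)"

definition neighbours :: "('a, 'b) pre_digraph \<Rightarrow> 'a \<Rightarrow> 'a set" where
  "neighbours G v = {u \<in> verts G. v \<rightarrow>\<^bsub>G\<^esub> u}"

text \<open>Vertices of \<open>S\<close> itself are not excluded.\<close>
definition nbhd :: "('a, 'b) pre_digraph \<Rightarrow> 'a set \<Rightarrow> 'a set" where
  "nbhd G S = {u \<in> verts G. \<exists>v\<in>S. v \<rightarrow>\<^bsub>G\<^esub> u}"

definition stable_set :: "('a, 'b) pre_digraph \<Rightarrow> 'a set \<Rightarrow> bool" where
  "stable_set G S \<longleftrightarrow> S \<subseteq> verts G \<and> (\<forall>u\<in>S. \<forall>v\<in>S. \<not> u \<rightarrow>\<^bsub>G\<^esub> v)"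

definition two_partition :: "('a, 'b) pre_digraph \<Rightarrow> 'a set \<Rightarrow> 'a set \<Rightarrow> bool" where
  "two_partition G V1 V2 \<longleftrightarrow>
     V1 \<noteq> {} \<and> V2 \<noteq> {} \<and> V1 \<inter> V2 = {} \<and> V1 \<union> V2 = verts G"

definition leaves :: "('a, 'b) pre_digraph \<Rightarrow> 'a set" where
  "leaves G = {v \<in> verts G. out_degree G v = 1}"

end

theory Submission
  imports Defs
begin

text \<open>
  Let \<open>A\<close> be the neighbourhood of the set \<open>S\<close> of leaves. Leaves cannot lie in \<open>V2\<close>, and hence
  \<open>A\<close> is forced into \<open>V2\<close>; this yields necessity. For sufficiency, let \<open>C\<close> be the set of vertices
  outside \<open>S \<union> A\<close> without neighbour in \<open>A\<close>, choose a maximal stable subset \<open>I\<close> of \<open>C\<close>, and take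
  \<open>V2 = A \<union> I\<close>. A vertex of \<open>I\<close> has degree at least two and all its neighbours lie in \<open>V1\<close>;
  a vertex of \<open>V1\<close> is dominated by \<open>A\<close> or, if it lies in \<open>C\<close>, by \<open>I\<close> by maximality.
\<close>

text \<open>\<open>head G\<close> maps the out-arcs of \<open>v\<close> onto its neighbours, and it
  is injective there because there are no parallel arcs.\<close>

lemma (in nomulti_digraph) card_neighbours: "card (neighbours G v) = out_degree G v"
proof -
  have "neighbours G v = head G ` out_arcs G v"
    by (auto simp: neighbours_def arcs_ends_conv out_arcs_def image_iff)
  moreover have "inj_on (head G) (out_arcs G v)"
    by (rule inj_onI) (auto simp: out_arcs_def arc_to_ends_def intro: no_multi_arcs)
  ultimately show ?thesis
    by (simp add: card_image out_degree_def)
qed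

lemma (in fin_digraph) finite_neighbours: "finite (neighbours G v)"
  by (simp add: neighbours_def)

text \<open>An inclusion-maximal stable \<open>I\<close> works: a vertex of \<open>C - I\<close>
  without neighbour in \<open>I\<close> could be inserted, since there are no loops and adjacency is
  symmetric.\<close>

lemma (in fin_digraph) obtain_maximal_stable_subset:
  assumes "C \<subseteq> verts G" "\<And>v. \<not> v \<rightarrow>\<^bsub>G\<^esub> v" "\<And>u v. u \<rightarrow>\<^bsub>G\<^esub> v \<Longrightarrow> v \<rightarrow>\<^bsub>G\<^esub> u"
  obtains I where "I \<subseteq> C" "stable_set G I" "\<And>v. v \<in> C - I \<Longrightarrow> \<exists>u\<in>I. v \<rightarrow>\<^bsub>G\<^esub> u"
proof -
  let ?F = "{I. I \<subseteq> C \<and> stable_set G I}"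
  have "finite C" using assms(1) finite_verts finite_subset by blast
  then have "finite ?F" by (auto intro: finite_subset[of _ "Pow C"])
  moreover have "{} \<in> ?F" by (simp add: stable_set_def)
  ultimately obtain I where I: "I \<in> ?F" and max: "\<And>J. J \<in> ?F \<Longrightarrow> I \<subseteq> J \<Longrightarrow> I = J"
    using finite_has_maximal[of ?F] by (metis (no_types, lifting) empty_iff)
  have "\<exists>u\<in>I. v \<rightarrow>\<^bsub>G\<^esub> u" if v: "v \<in> C - I" for v
  proof (rule ccontr)
    assume "\<not> ?thesis"
    then have "insert v I \<in> ?F"
      using I v assms unfolding stable_set_def by auto
    then show False using max v by blast
  qed
  with I that show thesis by blast
qed

lemma card_ge_2_iff_two_elements:
  "finite A \<Longrightarrow> 2 \<le> card A \<longleftrightarrow> (\<exists>x\<in>A. \<exists>y\<in>A. x \<noteq> y)"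
  using card_le_Suc0_iff_eq[of A] by (auto simp: not_less_eq_eq[symmetric] numeral_2_eq_2)

theorem theorem3p3:
  fixes G :: "('a, 'b) pre_digraph" and S1 :: "'a set"
  assumes "graph G"
    and "verts G \<noteq> {}"
    and "min_degree G = 1"
    and "S1 = leaves G"
  shows "(\<exists>V1 V2. two_partition G V1 V2
            \<and> (\<forall>v\<in>V1. card (neighbours G v \<inter> V2) \<ge> 1)
            \<and> (\<forall>v\<in>V2. card (neighbours G v \<inter> V1) \<ge> 2))
     \<longleftrightarrow> stable_set G S1
         \<and> (\<forall>v\<in>nbhd G S1. card (neighbours G v \<inter> S1) \<ge> 2
              \<or> card (neighbours G v \<inter> (verts G - (S1 \<union> nbhd G S1))) \<ge> 1)"
    (is "?L \<longleftrightarrow> ?R")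
proof -
  interpret graph G by fact
  let ?N = "neighbours G" and ?A = "nbhd G S1"
  have sym: "v \<rightarrow>\<^bsub>G\<^esub> u" if "u \<rightarrow>\<^bsub>G\<^esub> v" for u v
    using sym_arcs that by (auto simp: symmetric_def elim: symE)
  have irrefl: "\<not> v \<rightarrow>\<^bsub>G\<^esub> v" for v
    using adj_not_same by blast
  have N: "u \<in> ?N v \<longleftrightarrow> v \<rightarrow>\<^bsub>G\<^esub> u" for u v
    by (auto simp: neighbours_def)
  have ge1: "card (?N v \<inter> X) \<ge> 1 \<longleftrightarrow> (\<exists>u\<in>X. v \<rightarrow>\<^bsub>G\<^esub> u)" for v X
    using finite_neighbours[of v] by (auto simp: Suc_le_eq card_gt_0_iff N)
  have ge2: "card (?N v \<inter> X) \<ge> 2 \<longleftrightarrow> (\<exists>x\<in>X. \<exists>y\<in>X. x \<noteq> y \<and> v \<rightarrow>\<^bsub>G\<^esub> x \<and> v \<rightarrow>\<^bsub>G\<^esub> y)" for v X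
    using finite_neighbours[of v] by (simp add: card_ge_2_iff_two_elements Bex_def N) blast
  have A: "u \<in> ?A \<longleftrightarrow> (\<exists>v\<in>S1. v \<rightarrow>\<^bsub>G\<^esub> u)" for u
    by (auto simp: nbhd_def)
  have S1: "v \<in> S1 \<longleftrightarrow> v \<in> verts G \<and> card (?N v) = 1" for v
    using assms(4) by (simp add: leaves_def card_neighbours)
  have pos: "card (?N v) \<ge> 1" if "v \<in> verts G" for v
    using assms(3) that Min_le[of "out_degree G ` verts G" "out_degree G v"]
    by (simp add: min_degree_def card_neighbours)
  \<comment> \<open>The minimum is attained, so a leaf \<open>l\<close> exists; it will witness that
    both parts are nonempty.\<close>
  have "1 \<in> out_degree G ` verts G"
    using Min_in[of "out_degree G ` verts G"] assms(2,3)[unfolded min_degree_def] finite_verts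
    by (metis finite_imageI image_is_empty)
  then obtain l where l: "l \<in> S1" by (auto simp: S1 card_neighbours)
  show ?thesis
  proof
    assume ?L
    then obtain V1 V2 where part: "two_partition G V1 V2"
      and V1: "\<And>v. v \<in> V1 \<Longrightarrow> \<exists>u\<in>V2. v \<rightarrow>\<^bsub>G\<^esub> u"
      and V2: "\<And>v. v \<in> V2 \<Longrightarrow> \<exists>x\<in>V1. \<exists>y\<in>V1. x \<noteq> y \<and> v \<rightarrow>\<^bsub>G\<^esub> x \<and> v \<rightarrow>\<^bsub>G\<^esub> y"
      unfolding ge1 ge2 by blast
    have leaf: "x = y" if "v \<in> S1" "v \<rightarrow>\<^bsub>G\<^esub> x" "v \<rightarrow>\<^bsub>G\<^esub> y" for v x y
      using that by (metis S1 N card_1_singletonE singletonD)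
    have disj: "V1 \<inter> V2 = {}" and un: "V1 \<union> V2 = verts G"
      using part by (auto simp: two_partition_def)
    have SV: "S1 \<subseteq> V1"
      using leaf V2 un S1 by blast
    \<comment> \<open>A leaf lies in \<open>V1\<close>, so the neighbour it must have in
      \<open>V2\<close> is its only neighbour.\<close>
    have AV: "?A \<subseteq> V2"
      using leaf V1 SV A by blast
    \<comment> \<open>An edge between two leaves would put an end of it in both \<open>S1\<close>
      and \<open>?A\<close>, hence in both \<open>V1\<close> and \<open>V2\<close>.\<close>
    have "stable_set G S1"
      unfolding stable_set_def using SV AV A disj un by blast
    moreover have "card (?N v \<inter> S1) \<ge> 2 \<or> card (?N v \<inter> (verts G - (S1 \<union> ?A))) \<ge> 1"
      if "v \<in> ?A" for v
    proof -
      from that AV V2 obtain x y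
        where "x \<in> V1" "y \<in> V1" "x \<noteq> y" "v \<rightarrow>\<^bsub>G\<^esub> x" "v \<rightarrow>\<^bsub>G\<^esub> y" by blast
      \<comment> \<open>Both \<open>x\<close> and \<open>y\<close> avoid \<open>?A\<close>, as they
        lie in \<open>V1\<close>. Either both are leaves, or one of them lies outside
        \<open>S1\<close> and \<open>?A\<close>.\<close>
      then show ?thesis unfolding ge1 ge2 using AV disj un by blast
    qed
    ultimately show ?R by blast
  next
    assume R: ?R
    then have stable: "\<And>u v. u \<in> S1 \<Longrightarrow> v \<in> S1 \<Longrightarrow> \<not> u \<rightarrow>\<^bsub>G\<^esub> v"
      by (auto simp: stable_set_def)
    define C where "C = {v \<in> verts G - (S1 \<union> ?A). \<forall>u\<in>?A. \<not> v \<rightarrow>\<^bsub>G\<^esub> u}"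
    have "C \<subseteq> verts G" by (auto simp: C_def)
    then obtain I where I: "I \<subseteq> C" "stable_set G I" "\<And>v. v \<in> C - I \<Longrightarrow> \<exists>u\<in>I. v \<rightarrow>\<^bsub>G\<^esub> u"
      using obtain_maximal_stable_subset irrefl sym by metis
    define V2 where "V2 = ?A \<union> I"
    define V1 where "V1 = verts G - V2"
    \<comment> \<open>Stability enters here: a leaf in \<open>?A\<close> would be adjacent to
      another leaf.\<close>
    have SV: "S1 \<subseteq> V1"
      using I(1) stable A S1 by (auto simp: V1_def V2_def C_def)
    have leaf_nb: "\<exists>u\<in>?A. v \<rightarrow>\<^bsub>G\<^esub> u" if v: "v \<in> S1" for v
    proof -
      obtain u where "u \<in> ?N v"
        using v S1 by (metis card_1_singletonE singletonI)
      then show ?thesis using v A N by blast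
    qed
    \<comment> \<open>The leaf \<open>l\<close> lies in \<open>V1\<close>, and its neighbour lies in
      \<open>?A\<close>, hence in \<open>V2\<close>.\<close>
    have "two_partition G V1 V2"
      using l SV leaf_nb[OF l] I(1) by (auto simp: two_partition_def V1_def V2_def C_def nbhd_def)
    moreover have "\<exists>u\<in>V2. v \<rightarrow>\<^bsub>G\<^esub> u" if "v \<in> V1" for v
      using that leaf_nb I(3) unfolding V1_def V2_def C_def by blast
    moreover have "card (?N v \<inter> V1) \<ge> 2" if "v \<in> V2" for v
    proof (cases "v \<in> ?A")
      case True
      show ?thesis
      proof (cases "card (?N v \<inter> S1) \<ge> 2")
        case True
        then show ?thesis unfolding ge2 using SV by blast
      next
        case False
        then obtain w where w: "w \<in> verts G - (S1 \<union> ?A)" "v \<rightarrow>\<^bsub>G\<^esub> w"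
          using R \<open>v \<in> ?A\<close> unfolding ge1 by blast
        \<comment> \<open>\<open>w\<close> is adjacent to \<open>v\<close> in \<open>?A\<close>, so
          it is not in \<open>C\<close> and hence not in \<open>I\<close>.\<close>
        then have "w \<in> V1"
          using \<open>v \<in> ?A\<close> I(1) sym unfolding V1_def V2_def C_def by blast
        \<comment> \<open>The second neighbour in \<open>V1\<close> is a leaf, which differs from
          \<open>w\<close> because \<open>w\<close> is outside \<open>S1\<close>.\<close>
        moreover obtain s where "s \<in> S1" "v \<rightarrow>\<^bsub>G\<^esub> s"
          using \<open>v \<in> ?A\<close> A sym by blast
        ultimately show ?thesis unfolding ge2 using w SV by (intro bexI[of _ w] bexI[of _ s]) auto
      qed
    next
      case False
      then have v: "v \<in> I" "v \<in> C" using that I(1) by (auto simp: V2_def)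
      \<comment> \<open>Neighbours in \<open>?A\<close> are excluded by the definition of
        \<open>C\<close>, those in \<open>I\<close> by stability.\<close>
      have "?N v \<subseteq> V1"
        using v I(2) by (auto simp: V1_def V2_def C_def stable_set_def neighbours_def)
      moreover have "card (?N v) \<ge> 2"
        using pos[of v] S1[of v] v(2) by (auto simp: C_def)
      ultimately show ?thesis by (simp add: Int_absorb2)
    qed
    ultimately show ?L unfolding ge1 by blast
  qed
qed

end
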